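(* Let $\Bbbk$ be an algebraically closed field of characteristic $p>0$, let $C_p=\langle\sigma\rangle$ be the cyclic group of order $p$, let $V_2$ be its $2$-dimensional indecomposable representation over $\Bbbk$, and let $C_p$ act diagonally on $V_2^{\oplus n}$, $n\geq 1$. Let $x_1,y_1,\dots,x_n,y_n$ be coordinates on $V_2^{\oplus n}$ such that $\sigma\cdot x_i=x_i$ and $\sigma\cdot y_i=x_i+y_i$ for all $i$. Put \[u_{i,i}=y_i^p-x_i^{p-1}y_i\ (1\leq i\leq n),\qquad u_{i,j}=x_iy_j-x_jy_i\ (1\leq i<j\leq n),\] and, for $2\leq \ell\leq 2n$, \[S_\ell=\sum_{\substack{1\leq i\leq j\leq n\\ i+j=\ell}}u_{i,j}.\] Then the set $\{x_i : 1\leq i\leq n\}\cup\{S_\ell : 2\leq\ell\leq 2n\}$ is a separating set for $\Bbbk[V_2^{\oplus n}]^{C_p}$.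
   Context: For a finite group $G$ acting linearly on a vector space $V$ over $\Bbbk$, $\Bbbk[V]=\operatorname{Sym}(V^* )$ carries the induced action, $\Bbbk[V]^G$ is the ring of invariants, and a separating set is a subset $E\subset\Bbbk[V]^G$ such that whenever $v,w\in V$ have distinct $G$-orbits there is $h\in E$ with $h(v)\neq h(w)$. *)

theory Defs
  imports
    "HOL-Algebra.Generated_Groups"
    "HOL-Computational_Algebra.Polynomial"
    "HOL-Library.Poly_Mapping"
    "HOL-Library.Function_Algebras"
begin

section \<open>Linear representations of groups\<close>

text \<open>The representation space is a subspace \<open>V\<close> of an ambient vector space, so that spaces
  depending on a natural number, such as direct powers, can be used.  The action is relevant
  on \<open>V\<close> only.\<close>

locale linear_rep = group G + vs: vector_space scale
  for G :: "('g, 'm) monoid_scheme" (structure)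
    and scale :: "'k::field \<Rightarrow> 'v::ab_group_add \<Rightarrow> 'v" +
  fixes V :: "'v set" and act :: "'g \<Rightarrow> 'v \<Rightarrow> 'v"
  assumes subspace_V: "vs.subspace V"
    and act_closed: "\<lbrakk>g \<in> carrier G; v \<in> V\<rbrakk> \<Longrightarrow> act g v \<in> V"
    and act_add: "\<lbrakk>g \<in> carrier G; v \<in> V; w \<in> V\<rbrakk> \<Longrightarrow> act g (v + w) = act g v + act g w"
    and act_scale: "\<lbrakk>g \<in> carrier G; v \<in> V\<rbrakk> \<Longrightarrow> act g (scale c v) = scale c (act g v)"
    and act_one: "v \<in> V \<Longrightarrow> act \<one> v = v"
    and act_mult: "\<lbrakk>g \<in> carrier G; h \<in> carrier G; v \<in> V\<rbrakk> \<Longrightarrow> act (g \<otimes> h) v = act g (act h v)"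

definition indecomposable_rep ::
    "('g, 'm) monoid_scheme \<Rightarrow> ('k::field \<Rightarrow> 'v::ab_group_add \<Rightarrow> 'v) \<Rightarrow> 'v set
      \<Rightarrow> ('g \<Rightarrow> 'v \<Rightarrow> 'v) \<Rightarrow> bool" where
  "indecomposable_rep G scale V act \<longleftrightarrow>
     linear_rep G scale V act \<and> V \<noteq> {0} \<and>
     (\<forall>U W. linear_rep G scale U act \<and> linear_rep G scale W act \<and>
        U \<inter> W = {0} \<and> V = {u + w | u w. u \<in> U \<and> w \<in> W} \<longrightarrow> U = {0} \<or> W = {0})"

definition orbit :: "('g, 'm) monoid_scheme \<Rightarrow> ('g \<Rightarrow> 'v \<Rightarrow> 'v) \<Rightarrow> 'v \<Rightarrow> 'v set" where
  "orbit G act v = (\<lambda>g. act g v) ` carrier G"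

text \<open>The \<open>n\<close>-th direct power of a space consists of the families indexed by \<open>{1..n}\<close>,
  extended by \<open>0\<close> to all of \<open>nat\<close>; addition of families is the pointwise one.\<close>

definition power_space :: "nat \<Rightarrow> 'v::zero set \<Rightarrow> (nat \<Rightarrow> 'v) set" where
  "power_space n V = {v. (\<forall>i\<in>{1..n}. v i \<in> V) \<and> (\<forall>i. i \<notin> {1..n} \<longrightarrow> v i = 0)}"

definition power_scale :: "('k \<Rightarrow> 'v \<Rightarrow> 'v) \<Rightarrow> 'k \<Rightarrow> (nat \<Rightarrow> 'v) \<Rightarrow> nat \<Rightarrow> 'v" where
  "power_scale scale c v = (\<lambda>i. scale c (v i))"

definition diagonal_act :: "('g \<Rightarrow> 'v \<Rightarrow> 'v) \<Rightarrow> 'g \<Rightarrow> (nat \<Rightarrow> 'v) \<Rightarrow> nat \<Rightarrow> 'v" where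
  "diagonal_act act g v = (\<lambda>i. act g (v i))"

lemma (in linear_rep) act_zero:
  assumes "g \<in> carrier G"
  shows "act g 0 = 0"
  using act_scale[OF assms vs.subspace_0[OF subspace_V], of 0] by simp

lemma (in linear_rep) linear_rep_power:
  "linear_rep G (power_scale scale) (power_space n V) (diagonal_act act)"
proof -
  interpret P: vector_space "power_scale scale"
    by unfold_locales
      (auto simp: power_scale_def fun_eq_iff vs.scale_right_distrib vs.scale_left_distrib)
  have V: "0 \<in> V" "\<And>v w. v \<in> V \<Longrightarrow> w \<in> V \<Longrightarrow> v + w \<in> V" "\<And>c v. v \<in> V \<Longrightarrow> scale c v \<in> V"
    using subspace_V by (auto simp: vs.subspace_def)
  have mem: "v i \<in> V" if "v \<in> power_space n V" for v i
    using that V(1) by (cases "i \<in> {1..n}") (auto simp: power_space_def)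
  show ?thesis
  proof unfold_locales
    show "P.subspace (power_space n V)"
      unfolding P.subspace_def using V by (auto simp: power_space_def power_scale_def)
  next
    fix g v assume "g \<in> carrier G" "v \<in> power_space n V"
    then show "diagonal_act act g v \<in> power_space n V"
      by (auto simp: power_space_def diagonal_act_def act_closed act_zero)
  qed (auto simp: diagonal_act_def power_scale_def fun_eq_iff mem act_add act_scale act_one act_mult)
qed

section \<open>Polynomials\<close>

text \<open>Polynomials with coefficients in \<open>'k\<close> in variables indexed by \<open>'i\<close>: finitely supported
  maps from exponent vectors to coefficients, with the convolution product.\<close>

type_synonym ('i, 'k) mpoly = "('i \<Rightarrow>\<^sub>0 nat) \<Rightarrow>\<^sub>0 'k"

definition Const :: "'k::zero \<Rightarrow> ('i, 'k) mpoly" where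
  "Const c = Poly_Mapping.single 0 c"

definition Var :: "'i \<Rightarrow> ('i, 'k::zero_neq_one) mpoly" where
  "Var i = Poly_Mapping.single (Poly_Mapping.single i 1) 1"

definition vars :: "('i, 'k::zero) mpoly \<Rightarrow> 'i set" where
  "vars f = (\<Union>m\<in>Poly_Mapping.keys f. Poly_Mapping.keys m)"

text \<open>The value of a polynomial when its coefficients are mapped by \<open>h\<close> and the variable \<open>i\<close>
  is replaced by \<open>a i\<close>.\<close>

definition subst_poly ::
    "('k::zero \<Rightarrow> 'r::comm_semiring_1) \<Rightarrow> ('i \<Rightarrow> 'r) \<Rightarrow> ('i, 'k) mpoly \<Rightarrow> 'r" where
  "subst_poly h a f =
     (\<Sum>m\<in>Poly_Mapping.keys f. h (Poly_Mapping.lookup f m) *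
        (\<Prod>i\<in>Poly_Mapping.keys m. a i ^ Poly_Mapping.lookup m i))"

section \<open>Coordinate rings, invariants and separating sets\<close>

definition linear_form :: "('k::field \<Rightarrow> 'v::ab_group_add \<Rightarrow> 'v) \<Rightarrow> 'v set \<Rightarrow> ('v \<Rightarrow> 'k) \<Rightarrow> bool" where
  "linear_form scale V f \<longleftrightarrow>
     (\<forall>v\<in>V. \<forall>w\<in>V. f (v + w) = f v + f w) \<and> (\<forall>c. \<forall>v\<in>V. f (scale c v) = c * f v)"

text \<open>Linear coordinates on \<open>V\<close>: linear forms \<open>z i\<close>, \<open>i \<in> I\<close>, which together identify \<open>V\<close>
  with the space of all families of scalars indexed by the finite set \<open>I\<close>.\<close>

definition coordinates ::
    "('k::field \<Rightarrow> 'v::ab_group_add \<Rightarrow> 'v) \<Rightarrow> 'v set \<Rightarrow> 'i set \<Rightarrow> ('i \<Rightarrow> 'v \<Rightarrow> 'k) \<Rightarrow> bool" where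
  "coordinates scale V I z \<longleftrightarrow>
     finite I \<and> (\<forall>i\<in>I. linear_form scale V (z i)) \<and>
     bij_betw (\<lambda>v. \<lambda>i\<in>I. z i v) V (I \<rightarrow>\<^sub>E UNIV)"

text \<open>Relative to coordinates \<open>z i\<close>, \<open>i \<in> I\<close>, which form a basis of the dual space, the
  symmetric algebra of the dual is the polynomial ring in the variables \<open>Var i\<close>, \<open>i \<in> I\<close>,
  where \<open>Var i\<close> stands for \<open>z i\<close>.\<close>

definition coord_ring :: "'i set \<Rightarrow> ('i, 'k::zero) mpoly set" where
  "coord_ring I = {f. vars f \<subseteq> I}"

definition poly_value :: "('i \<Rightarrow> 'v \<Rightarrow> 'k) \<Rightarrow> ('i, 'k::field) mpoly \<Rightarrow> 'v \<Rightarrow> 'k" where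
  "poly_value z f v = subst_poly (\<lambda>c. c) (\<lambda>i. z i v) f"

definition form_coeffs :: "'v set \<Rightarrow> 'i set \<Rightarrow> ('i \<Rightarrow> 'v \<Rightarrow> 'k::field) \<Rightarrow> ('v \<Rightarrow> 'k) \<Rightarrow> 'i \<Rightarrow> 'k" where
  "form_coeffs V I z f = (THE c. c \<in> I \<rightarrow>\<^sub>E UNIV \<and> (\<forall>v\<in>V. f v = (\<Sum>i\<in>I. c i * z i v)))"

text \<open>A linear form viewed as a homogeneous polynomial of degree \<open>1\<close>.\<close>

definition form_poly ::
    "'v set \<Rightarrow> 'i set \<Rightarrow> ('i \<Rightarrow> 'v \<Rightarrow> 'k::field) \<Rightarrow> ('v \<Rightarrow> 'k) \<Rightarrow> ('i, 'k) mpoly" where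
  "form_poly V I z f = (\<Sum>i\<in>I. Const (form_coeffs V I z f i) * Var i)"

definition dual_act ::
    "('g, 'm) monoid_scheme \<Rightarrow> ('g \<Rightarrow> 'v \<Rightarrow> 'v) \<Rightarrow> 'g \<Rightarrow> ('v \<Rightarrow> 'k) \<Rightarrow> 'v \<Rightarrow> 'k" where
  "dual_act G act g f = (\<lambda>v. f (act (inv\<^bsub>G\<^esub> g) v))"

text \<open>The induced action by algebra automorphisms, extending the action on linear forms.\<close>

definition poly_act ::
    "('g, 'm) monoid_scheme \<Rightarrow> 'v set \<Rightarrow> ('g \<Rightarrow> 'v \<Rightarrow> 'v) \<Rightarrow> 'i set \<Rightarrow> ('i \<Rightarrow> 'v \<Rightarrow> 'k::field)
      \<Rightarrow> 'g \<Rightarrow> ('i, 'k) mpoly \<Rightarrow> ('i, 'k) mpoly" where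
  "poly_act G V act I z g f =
     subst_poly Const (\<lambda>i. form_poly V I z (dual_act G act g (z i))) f"

definition invariant_ring ::
    "('g, 'm) monoid_scheme \<Rightarrow> 'v set \<Rightarrow> ('g \<Rightarrow> 'v \<Rightarrow> 'v) \<Rightarrow> 'i set \<Rightarrow> ('i \<Rightarrow> 'v \<Rightarrow> 'k::field)
      \<Rightarrow> ('i, 'k) mpoly set" where
  "invariant_ring G V act I z =
     {f \<in> coord_ring I. \<forall>g\<in>carrier G. poly_act G V act I z g f = f}"

definition separating_set ::
    "('g, 'm) monoid_scheme \<Rightarrow> 'v set \<Rightarrow> ('g \<Rightarrow> 'v \<Rightarrow> 'v) \<Rightarrow> 'i set \<Rightarrow> ('i \<Rightarrow> 'v \<Rightarrow> 'k::field)
      \<Rightarrow> ('i, 'k) mpoly set \<Rightarrow> bool" where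
  "separating_set G V act I z E \<longleftrightarrow>
     E \<subseteq> invariant_ring G V act I z \<and>
     (\<forall>v\<in>V. \<forall>w\<in>V. orbit G act v \<noteq> orbit G act w \<longrightarrow>
        (\<exists>h\<in>E. poly_value z h v \<noteq> poly_value z h w))"

section \<open>The polynomials \<open>u\<^sub>i\<^sub>j\<close> and \<open>S\<^sub>l\<close>\<close>

datatype coord = X nat | Y nat

definition coord_indices :: "nat \<Rightarrow> coord set" where
  "coord_indices n = X ` {1..n} \<union> Y ` {1..n}"

text \<open>Only used for \<open>i \<le> j\<close>.\<close>

definition u_poly :: "nat \<Rightarrow> nat \<Rightarrow> nat \<Rightarrow> (coord, 'k::field) mpoly" where
  "u_poly p i j =
     (if i = j then Var (Y i) ^ p - Var (X i) ^ (p - 1) * Var (Y i)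
      else Var (X i) * Var (Y j) - Var (X j) * Var (Y i))"

definition S_poly :: "nat \<Rightarrow> nat \<Rightarrow> nat \<Rightarrow> (coord, 'k::field) mpoly" where
  "S_poly p n l = (\<Sum>(i, j) \<in> {(i, j). 1 \<le> i \<and> i \<le> j \<and> j \<le> n \<and> i + j = l}. u_poly p i j)"

end

theory Submission
  imports Defs "HOL-Computational_Algebra.Primes"
begin

text \<open>
  Let \<open>v\<close> and \<open>w\<close> be points on which all \<open>x\<^sub>i\<close> and \<open>S\<^sub>l\<close> agree, let \<open>a\<^sub>i\<close> be the common values of
  the \<open>x\<^sub>i\<close>, and let \<open>d\<^sub>i = y\<^sub>i(w) - y\<^sub>i(v)\<close>.  Since \<open>u\<^sub>i\<^sub>j\<close> is additive in the \<open>y\<close>-coordinates, the sums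
  \<open>S\<^sub>l\<close> with \<open>d\<close> in place of \<open>y\<close> vanish.  Let \<open>r\<close> be minimal with \<open>a\<^sub>r \<noteq> 0\<close>.
  By induction, \<open>S\<^sub>2\<^sub>i\<close> reduces to \<open>d\<^sub>i\<^sup>p = 0\<close> for \<open>i < r\<close>; next, \<open>S\<^sub>2\<^sub>r\<close> reduces to
  \<open>d\<^sub>r\<^sup>p = a\<^sub>r\<^sup>p\<^sup>-\<^sup>1 d\<^sub>r\<close>, so that \<open>d\<^sub>r = t a\<^sub>r\<close> with \<open>t\<close> in the prime field; and for \<open>i > r\<close>, \<open>S\<^sub>r\<^sub>+\<^sub>i\<close>
  reduces to \<open>a\<^sub>r d\<^sub>i = a\<^sub>i d\<^sub>r\<close>.  Hence \<open>d = t a\<close>, and a power of \<open>\<sigma>\<close> maps \<open>v\<close> to \<open>w\<close>.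
\<close>

section \<open>Substitution as a ring homomorphism\<close>

text \<open>Updating a finitely supported map outside its support amounts to adding a
  \<open>single\<close>, so single terms and sums exhaust all polynomials. This reduces
  multiplicativity of substitution to monomials.\<close>

lemma mpoly_induct [case_names zero single add]:
  fixes f :: "'a \<Rightarrow>\<^sub>0 'b::comm_monoid_add"
  assumes "P 0"
    and single: "\<And>m c. P (Poly_Mapping.single m c)"
    and add: "\<And>f g. P f \<Longrightarrow> P g \<Longrightarrow> P (f + g)"
  shows "P f"
proof (induction f rule: update_induct)
  case const
  show ?case by fact
next
  case (update f a b)
  have "Poly_Mapping.update a b f = f + Poly_Mapping.single a b"
    using update by (intro poly_mapping_eqI)
      (auto simp: lookup_update lookup_add lookup_single in_keys_iff when_def)
  then show ?case
    using add[OF update(3) single] by simp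
qed

text \<open>Factors with exponent 0 are 1, so all three products may be taken over the union of the
  two supports, where exponents add.\<close>

lemma prod_power_keys_add:
  fixes a :: "'i \<Rightarrow> 'r::comm_semiring_1"
  shows "(\<Prod>i\<in>Poly_Mapping.keys (m + m'). a i ^ Poly_Mapping.lookup (m + m') i) =
    (\<Prod>i\<in>Poly_Mapping.keys m. a i ^ Poly_Mapping.lookup m i) *
    (\<Prod>i\<in>Poly_Mapping.keys m'. a i ^ Poly_Mapping.lookup m' i)"
proof -
  let ?K = "Poly_Mapping.keys m \<union> Poly_Mapping.keys m'"
  have ext: "(\<Prod>i\<in>Poly_Mapping.keys q. a i ^ Poly_Mapping.lookup q i) =
      (\<Prod>i\<in>?K. a i ^ Poly_Mapping.lookup q i)" if "Poly_Mapping.keys q \<subseteq> ?K" for q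
    using that by (intro prod.mono_neutral_left) (auto simp: in_keys_iff)
  have "(\<Prod>i\<in>Poly_Mapping.keys (m + m'). a i ^ Poly_Mapping.lookup (m + m') i) =
      (\<Prod>i\<in>?K. a i ^ Poly_Mapping.lookup (m + m') i)"
    by (rule ext) (rule Poly_Mapping.keys_add)
  also have "\<dots> = (\<Prod>i\<in>?K. a i ^ Poly_Mapping.lookup m i) *
      (\<Prod>i\<in>?K. a i ^ Poly_Mapping.lookup m' i)"
    by (simp add: lookup_add power_add prod.distrib)
  finally show ?thesis
    by (simp add: ext)
qed

text \<open>Two instances are used: the identity, which makes substitution the evaluation at a
  point, and \<open>Const\<close>, which makes it the action of a group element on
  polynomials.\<close>

locale coeff_hom =
  fixes h :: "'k::field \<Rightarrow> 'r::comm_ring_1"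
  assumes h_zero [simp]: "h 0 = 0" and h_one [simp]: "h 1 = 1"
    and h_add: "h (c + d) = h c + h d" and h_mult: "h (c * d) = h c * h d"
begin

lemma subst_poly_zero [simp]: "subst_poly h a 0 = 0"
  by (simp add: subst_poly_def)

lemma subst_poly_single:
  "subst_poly h a (Poly_Mapping.single m c) =
     h c * (\<Prod>i\<in>Poly_Mapping.keys m. a i ^ Poly_Mapping.lookup m i)"
  by (cases "c = 0") (simp_all add: subst_poly_def)

lemma subst_poly_Var [simp]: "subst_poly h a (Var i) = a i"
  by (simp add: Var_def subst_poly_single)

lemma subst_poly_add: "subst_poly h a (f + g) = subst_poly h a f + subst_poly h a g"
  unfolding subst_poly_def
  by (rule setsum_keys_plus_distrib) (simp_all add: h_add distrib_right)

lemma subst_poly_diff: "subst_poly h a (f - g) = subst_poly h a f - subst_poly h a g"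
  using subst_poly_add[of a "f - g" g] by (simp add: algebra_simps)

lemma subst_poly_sum: "subst_poly h a (sum f A) = (\<Sum>i\<in>A. subst_poly h a (f i))"
  by (induction A rule: infinite_finite_induct) (simp_all add: subst_poly_add)

lemma subst_poly_mult: "subst_poly h a (f * g) = subst_poly h a f * subst_poly h a g"
proof (induction f rule: mpoly_induct)
  case (single m c)
  show ?case
  proof (induction g rule: mpoly_induct)
    case (single m' c')
    show ?case
      by (simp add: mult_single subst_poly_single prod_power_keys_add h_mult mult_ac)
  qed (simp_all add: distrib_left subst_poly_add)
qed (simp_all add: distrib_right subst_poly_add)

lemma subst_poly_one [simp]: "subst_poly h a 1 = 1"
  using subst_poly_single[of a 0 1] by simp

lemma subst_poly_power: "subst_poly h a (f ^ k) = subst_poly h a f ^ k"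
  by (induction k) (simp_all add: subst_poly_mult)

lemmas subst_poly_simps = subst_poly_diff subst_poly_mult subst_poly_power

lemma subst_poly_u_poly:
  fixes f :: "coord \<Rightarrow> 'r"
  shows "subst_poly h a (u_poly p i j) =
    (if i = j then a (Y i) ^ p - a (X i) ^ (p - 1) * a (Y i)
     else a (X i) * a (Y j) - a (X j) * a (Y i))"
  by (simp add: u_poly_def subst_poly_simps)

end

lemma coeff_hom_id: "coeff_hom (\<lambda>c. c :: 'k::field)"
  by unfold_locales simp_all

lemma coeff_hom_Const: "coeff_hom (Const :: 'k::field \<Rightarrow> ('i, 'k) mpoly)"
  by unfold_locales (simp_all add: Const_def single_add mult_single)

text \<open>Natural numbers map to constant polynomials. The lemma makes the Frobenius identity
  available for polynomials, as needed for the invariance of \<open>u_poly p i i\<close>.\<close>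

lemma CHAR_mpoly: "CHAR(('i, 'k::comm_ring_1) mpoly) = CHAR('k)"
proof (rule CHAR_eqI)
  have of_nat: "(of_nat c :: ('i, 'k) mpoly) = Poly_Mapping.single 0 (of_nat c)" for c
    by simp
  show "(of_nat CHAR('k) :: ('i, 'k) mpoly) = 0"
    unfolding of_nat by simp
  show "CHAR('k) dvd c" if "(of_nat c :: ('i, 'k) mpoly) = 0" for c
  proof -
    have "of_nat c = Poly_Mapping.lookup (of_nat c :: ('i, 'k) mpoly) 0"
      by (simp add: lookup_of_nat)
    then show ?thesis
      using that by (simp add: of_nat_eq_0_iff_char_dvd)
  qed
qed

section \<open>Coordinate rings\<close>

lemma coord_ring_diff: "f \<in> coord_ring I \<Longrightarrow> g \<in> coord_ring I \<Longrightarrow> f - g \<in> coord_ring I"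
  for f g :: "('i, 'k::comm_ring_1) mpoly"
proof -
  assume "f \<in> coord_ring I" "g \<in> coord_ring I"
  moreover have "Poly_Mapping.keys (f - g) \<subseteq> Poly_Mapping.keys f \<union> Poly_Mapping.keys g"
    by (auto simp: in_keys_iff lookup_minus)
  ultimately show ?thesis
    unfolding coord_ring_def vars_def by blast
qed

lemma coord_ring_sum:
  fixes f :: "'a \<Rightarrow> ('i, 'k::comm_ring_1) mpoly"
  assumes "\<And>a. a \<in> A \<Longrightarrow> f a \<in> coord_ring I"
  shows "sum f A \<in> coord_ring I"
  using assms Poly_Mapping.keys_sum[of f A] unfolding coord_ring_def vars_def by blast

lemma coord_ring_mult: "f \<in> coord_ring I \<Longrightarrow> g \<in> coord_ring I \<Longrightarrow> f * g \<in> coord_ring I"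
  for f g :: "('i, 'k::comm_ring_1) mpoly"
proof -
  assume fg: "f \<in> coord_ring I" "g \<in> coord_ring I"
  have "Poly_Mapping.keys m \<subseteq> I" if m: "m \<in> Poly_Mapping.keys (f * g)" for m
  proof -
    obtain a b where "m = a + b" "a \<in> Poly_Mapping.keys f" "b \<in> Poly_Mapping.keys g"
      using m keys_mult[of f g] by blast
    then show ?thesis
      using fg Poly_Mapping.keys_add[of a b] unfolding coord_ring_def vars_def by blast
  qed
  then show ?thesis
    unfolding coord_ring_def vars_def by blast
qed

lemma coord_ring_power: "f \<in> coord_ring I \<Longrightarrow> f ^ k \<in> coord_ring I"
  for f :: "('i, 'k::comm_ring_1) mpoly"
  by (induction k) (simp_all add: coord_ring_mult, simp add: coord_ring_def vars_def)

lemma coord_ring_Var: "i \<in> I \<Longrightarrow> Var i \<in> coord_ring I"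
  by (simp add: coord_ring_def vars_def Var_def)

lemma u_poly_coord_ring:
  assumes "i \<in> {1..n}" "j \<in> {1..n}"
  shows "u_poly p i j \<in> coord_ring (coord_indices n)"
  using assms unfolding u_poly_def
  by (auto simp: coord_indices_def intro!: coord_ring_diff coord_ring_mult coord_ring_power coord_ring_Var)

lemma S_poly_coord_ring: "S_poly p n l \<in> coord_ring (coord_indices n)"
  unfolding S_poly_def by (auto intro!: coord_ring_sum u_poly_coord_ring)

lemma coordinates_eqI:
  assumes "coordinates scale V I z" "v \<in> V" "w \<in> V" "\<And>i. i \<in> I \<Longrightarrow> z i v = z i w"
  shows "v = w"
proof -
  have "inj_on (\<lambda>v. \<lambda>i\<in>I. z i v) V"
    using assms(1) by (simp add: coordinates_def bij_betw_def)
  then show ?thesis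
    using assms(2-) by (auto intro!: restrict_ext elim!: inj_onD)
qed

lemma coordinates_obtain:
  assumes "coordinates scale V I z"
  obtains v where "v \<in> V" "\<And>i. i \<in> I \<Longrightarrow> z i v = c i"
proof -
  have "(\<lambda>v. \<lambda>i\<in>I. z i v) ` V = I \<rightarrow>\<^sub>E UNIV"
    using assms by (simp add: coordinates_def bij_betw_def)
  then have "restrict c I \<in> (\<lambda>v. \<lambda>i\<in>I. z i v) ` V"
    by auto
  then obtain v where v: "v \<in> V" "restrict c I = (\<lambda>i\<in>I. z i v)"
    by blast
  show ?thesis
  proof (rule that[OF v(1)])
    show "z i v = c i" if "i \<in> I" for i
      using fun_cong[OF v(2), of i] that by simp
  qed
qed

lemma form_coeffs_eq:
  assumes coords: "coordinates scale V I z" and c: "c \<in> I \<rightarrow>\<^sub>E UNIV"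
    and f: "\<And>v. v \<in> V \<Longrightarrow> f v = (\<Sum>i\<in>I. c i * z i v)"
  shows "form_coeffs V I z f = c"
  unfolding form_coeffs_def
proof (rule the_equality)
  fix d assume d: "d \<in> I \<rightarrow>\<^sub>E UNIV \<and> (\<forall>v\<in>V. f v = (\<Sum>i\<in>I. d i * z i v))"
  show "d = c"
  proof (rule PiE_ext)
    fix j assume j: "j \<in> I"
    \<comment> \<open>Evaluation at the point dual to \<open>z j\<close> isolates the coefficient
      with index \<open>j\<close>.\<close>
    obtain v where v: "v \<in> V" "\<And>i. i \<in> I \<Longrightarrow> z i v = (if i = j then 1 else 0)"
      using coordinates_obtain[OF coords, of "\<lambda>i. if i = j then 1 else 0"] by blast
    have "finite I"
      using coords by (simp add: coordinates_def)
    then have "(\<Sum>i\<in>I. e i * z i v) = e j" for e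
      using j v(2) by (simp add: if_distrib[of "\<lambda>a. _ * a"] cong: if_cong)
    then show "d j = c j"
      using d f v(1) by metis
  qed (use c d in auto)
qed (use c f in auto)

lemma form_poly_eq:
  fixes z :: "'i \<Rightarrow> 'v::ab_group_add \<Rightarrow> 'k::field"
  assumes coords: "coordinates scale V I z" and ij: "i \<in> I" "j \<in> I"
    and f: "\<And>v. v \<in> V \<Longrightarrow> f v = z i v + c * z j v"
  shows "form_poly V I z f = Var i + Const c * Var j"
proof -
  have fin: "finite I"
    using coords by (simp add: coordinates_def)
  \<comment> \<open>A sum of two indicators, so that \<open>i = j\<close> is allowed; the fixed
    coordinates use this case with \<open>c = 0\<close>.\<close>
  define e where "e = (\<lambda>k\<in>I. (if k = i then 1 else 0) + (if k = j then c else 0))"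
  have "f v = (\<Sum>k\<in>I. e k * z k v)" if "v \<in> V" for v
    using that fin ij
    by (simp add: f e_def distrib_right sum.distrib if_distrib[of "\<lambda>a. a * _"] cong: if_cong)
  then have "form_coeffs V I z f = e"
    by (intro form_coeffs_eq[OF coords]) (auto simp: e_def)
  then have "form_poly V I z f = (\<Sum>k\<in>I. (if k = i then Var k else 0) + (if k = j then Const c * Var k else 0))"
    unfolding form_poly_def by (intro sum.cong) (auto simp: e_def Const_def single_add distrib_right)
  then show ?thesis
    using fin ij by (simp add: sum.distrib)
qed

section \<open>The prime field and the vanishing of the sums\<close>

text \<open>Fermat's little theorem, by induction from the Frobenius identity
  \<open>(1 + m)^p = 1 + m^p\<close>.\<close>

lemma of_nat_power_CHAR:
  fixes m :: nat
  assumes "prime CHAR('k::comm_semiring_1)"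
  shows "(of_nat m :: 'k) ^ CHAR('k) = of_nat m"
proof (induction m)
  case 0
  then show ?case
    using prime_gt_0_nat[OF assms] by (simp add: zero_power)
next
  case (Suc m)
  then show ?case
    using freshmans_dream[OF assms refl, of 1 "of_nat m"] by simp
qed

text \<open>The polynomial \<open>T^p - T\<close> has at most \<open>p\<close> roots, and by
  Fermat's little theorem \<open>0, ..., p - 1\<close> already give \<open>p\<close> distinct
  ones.\<close>

lemma power_CHAR_fixed_imp_of_nat:
  fixes t :: "'k::idom"
  assumes "prime CHAR('k)" "t ^ CHAR('k) = t"
  obtains m where "t = of_nat m"
proof -
  define p where "p = CHAR('k)"
  have p: "prime p" "p > 1"
    using assms(1) prime_gt_1_nat[OF assms(1)] by (simp_all add: p_def)
  define q where "q = (monom 1 p - monom 1 1 :: 'k poly)"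
  have root: "poly q a = 0 \<longleftrightarrow> a ^ p = a" for a
    by (simp add: q_def poly_monom)
  have "coeff q p = 1"
    using p by (simp add: q_def)
  then have q: "q \<noteq> 0"
    by auto
  have "degree q \<le> p"
    unfolding q_def using p by (intro degree_diff_le order.trans[OF degree_monom_le]) auto
  then have card_le: "card {a. poly q a = 0} \<le> p"
    using card_poly_roots_bound[OF q] by simp
  have "inj_on (of_nat :: nat \<Rightarrow> 'k) {..<p}"
  proof (rule linorder_inj_onI)
    fix i j :: nat assume ij: "i < j" "i \<in> {..<p}" "j \<in> {..<p}"
    then have "\<not> p dvd j - i"
      by (auto dest: dvd_imp_le)
    then have "of_nat (j - i) \<noteq> (0 :: 'k)"
      by (simp add: of_nat_eq_0_iff_char_dvd p_def)
    then show "of_nat i \<noteq> (of_nat j :: 'k)"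
      using ij by (simp add: of_nat_diff)
  qed auto
  then have "card ((of_nat :: nat \<Rightarrow> 'k) ` {..<p}) = p"
    by (simp add: card_image)
  moreover have sub: "of_nat ` {..<p} \<subseteq> {a. poly q a = 0}"
    using of_nat_power_CHAR[OF assms(1)] by (auto simp: root p_def)
  moreover have "finite {a. poly q a = 0}"
    by (rule poly_roots_finite[OF q])
  ultimately have "of_nat ` {..<p} = {a. poly q a = 0}"
    using card_le by (intro card_seteq) auto
  then show ?thesis
    using assms(2) that root[of t] by (auto simp: p_def)
qed

text \<open>Here \<open>a\<close> and \<open>d\<close> are the common \<open>x\<close>-coordinates and the difference of the
  \<open>y\<close>-coordinates of two points.\<close>

lemma vanishing_sums_imp_multiple:
  fixes a d :: "nat \<Rightarrow> 'k::field" and p n :: nat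
  defines "e \<equiv> \<lambda>i j. if i = j then d i ^ p - a i ^ (p - 1) * d i else a i * d j - a j * d i"
  assumes p: "p > 1"
    and sums: "\<And>l. l \<in> {2..2 * n} \<Longrightarrow>
      (\<Sum>(i, j) \<in> {(i, j). 1 \<le> i \<and> i \<le> j \<and> j \<le> n \<and> i + j = l}. e i j) = 0"
  obtains t where "t ^ p = t" "\<And>i. i \<in> {1..n} \<Longrightarrow> d i = t * a i"
proof -
  \<comment> \<open>The exponent \<open>p - 1\<close> is positive, so \<open>a j = 0\<close> leaves
    only \<open>d j ^ p = 0\<close>.\<close>
  have zero: "d j = 0" if "d j ^ p = a j ^ (p - 1) * d j" "a j = 0" for j
    using that p by (simp add: zero_power)
  \<comment> \<open>A term is zero once all others with the same index sum are; the first index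
    determines the pair.\<close>
  have single: "e r s = 0" if rs: "1 \<le> r" "r \<le> s" "s \<le> n"
    and other: "\<And>i j. \<lbrakk>1 \<le> i; i \<le> j; j \<le> n; i + j = r + s; i \<noteq> r\<rbrakk> \<Longrightarrow> e i j = 0" for r s
  proof -
    let ?P = "{(i, j). 1 \<le> i \<and> i \<le> j \<and> j \<le> n \<and> i + j = r + s}"
    have "?P \<subseteq> {..n} \<times> {..n}"
      by auto
    then have fin: "finite ?P"
      by (rule finite_subset) auto
    have "(\<Sum>(i, j)\<in>?P. e i j) = (\<Sum>(i, j)\<in>{(r, s)}. e i j)"
    proof (rule sum.mono_neutral_right[OF fin], use rs in simp, rule ballI)
      fix q assume q: "q \<in> ?P - {(r, s)}"
      obtain i j where ij: "q = (i, j)"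
        by (cases q)
      with q have "e i j = 0"
        by (intro other) auto
      then show "(case q of (i, j) \<Rightarrow> e i j) = 0"
        using ij by simp
    qed
    then show ?thesis
      using sums[of "r + s"] rs by simp
  qed
  \<comment> \<open>Only the \<open>a j\<close> strictly below \<open>i\<close> must vanish, so the
    first index with \<open>a i \<noteq> 0\<close> is covered too. In the sum for
    \<open>2 * i\<close>, an off-diagonal pair has its smaller entry \<open>j < i\<close>, where
    \<open>a j\<close> and \<open>d j\<close> vanish.\<close>
  have diag: "d i ^ p = a i ^ (p - 1) * d i"
    if "1 \<le> i" "i \<le> n" "\<And>j. 1 \<le> j \<Longrightarrow> j < i \<Longrightarrow> a j = 0" for i
    using that
  proof (induction i rule: less_induct)
    case (less i)
    have d0: "d j = 0" if "1 \<le> j" "j < i" for j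
      using that less.prems by (intro zero less.IH) auto
    have "e i i = 0"
    proof (rule single)
      fix j k assume "1 \<le> j" "j \<le> k" "j + k = i + i" "j \<noteq> i"
      then have "1 \<le> j" "j < i" "j \<noteq> k"
        by auto
      then show "e j k = 0"
        using d0[of j] less.prems(3)[of j] by (simp add: e_def)
    qed (use less.prems in auto)
    then show ?case
      by (simp add: e_def)
  qed
  show ?thesis
  proof (cases "\<exists>i\<in>{1..n}. a i \<noteq> 0")
    case False
    then have a0: "a i = 0" if "1 \<le> i" "i \<le> n" for i
      using that by auto
    have "d i = 0 * a i" if "i \<in> {1..n}" for i
      using that zero[OF diag[of i]] a0 by auto
    then show ?thesis
      using p by (intro that[of 0]) auto
  next
    case True
    then have "\<exists>r. r \<in> {1..n} \<and> a r \<noteq> 0"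
      by blast
    then obtain r where r: "r \<in> {1..n}" "a r \<noteq> 0"
      and least: "\<And>j. j < r \<Longrightarrow> \<not> (j \<in> {1..n} \<and> a j \<noteq> 0)"
      by (auto simp only: exists_least_iff[of "\<lambda>r. r \<in> {1..n} \<and> a r \<noteq> 0"])
    have a0: "a j = 0" if "1 \<le> j" "j < r" for j
      using least[of j] that r(1) by auto
    have d0: "d j = 0" if "1 \<le> j" "j < r" for j
      using that r(1) by (intro zero diag a0) auto
    define t where "t = d r / a r"
    have dr: "d r = t * a r"
      using r by (simp add: t_def)
    have "d r ^ p = a r ^ (p - 1) * d r"
      using r(1) by (intro diag a0) auto
    then have "t ^ p * a r ^ p = t * (a r ^ (p - 1) * a r)"
      unfolding dr by (simp add: power_mult_distrib mult_ac)
    then have t: "t ^ p = t"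
      using r(2) p power_minus_mult[of p "a r"] by simp
    have "d i = t * a i" if "1 \<le> i" "i \<le> n" for i
      using that
    proof (induction i rule: less_induct)
      case (less i)
      consider "i < r" | "i = r" | "r < i"
        by linarith
      then show ?case
      proof cases
        case 3
        \<comment> \<open>In the sum for \<open>r + i\<close>, pairs with \<open>j < r\<close>
          contribute nothing because \<open>a j = d j = 0\<close>. In the other pairs with
          \<open>j \<noteq> r\<close>, both entries lie strictly between \<open>r\<close> and
          \<open>i\<close>, where \<open>d = t a\<close> by induction; such a term vanishes by
          antisymmetry off the diagonal and by \<open>t ^ p = t\<close> on it.\<close>
        have "e r i = 0"
        proof (rule single)
          fix j k assume jk: "1 \<le> j" "j \<le> k" "k \<le> n" "j + k = r + i" "j \<noteq> r"
          show "e j k = 0"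
          proof (cases "j < r")
            case True
            then show ?thesis
              using a0[of j] d0[of j] jk 3 by (auto simp: e_def)
          next
            case False
            then have "j < i" "k < i"
              using jk by auto
            then have "d j = t * a j" "d k = t * a k"
              using less.IH jk by auto
            moreover have "(t * a j) ^ p = t * (a j ^ (p - 1) * a j)"
              using t power_minus_mult[of p "a j"] p by (simp add: power_mult_distrib)
            ultimately show ?thesis
              by (auto simp: e_def mult_ac)
          qed
        qed (use 3 r less.prems in auto)
        then have "a r * d i = a r * (t * a i)"
          using 3 by (simp add: e_def dr mult_ac)
        then show ?thesis
          using r by simp
      qed (use a0[of i] d0[of i] dr less.prems in auto)
    qed
    then show ?thesis
      using t by (intro that[of t]) auto
  qed
qed

theorem proposition5p3:
  fixes G :: "('g, 'm) monoid_scheme" and \<sigma> :: 'g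
    and scale :: "'k::alg_closed_field \<Rightarrow> 'v::ab_group_add \<Rightarrow> 'v"
    and act :: "'g \<Rightarrow> 'v \<Rightarrow> 'v"
    and x y :: "nat \<Rightarrow> (nat \<Rightarrow> 'v) \<Rightarrow> 'k"
    and p n :: nat
  defines "V \<equiv> power_space n (UNIV :: 'v set)"
    and "dact \<equiv> diagonal_act act"
    and "I \<equiv> coord_indices n"
    and "z \<equiv> case_coord x y"
  assumes char: "CHAR('k) = p" "p > 0"
    and cyclic: "group G" "\<sigma> \<in> carrier G" "generate G {\<sigma>} = carrier G" "Coset.order G = p"
    and V2: "linear_rep G scale UNIV act" "vector_space.dim scale (UNIV :: 'v set) = 2"
      "indecomposable_rep G scale UNIV act"
    and n: "n \<ge> 1"
    and coords: "coordinates (power_scale scale) V I z"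
    and \<sigma>_x: "\<And>i v. i \<in> {1..n} \<Longrightarrow> v \<in> V \<Longrightarrow> dual_act G dact \<sigma> (x i) v = x i v"
    and \<sigma>_y: "\<And>i v. i \<in> {1..n} \<Longrightarrow> v \<in> V \<Longrightarrow> dual_act G dact \<sigma> (y i) v = x i v + y i v"
  shows "separating_set G V dact I z
           ({Var (X i) | i. i \<in> {1..n}} \<union> {S_poly p n l | l. l \<in> {2..2 * n}})"
proof -
  interpret R: linear_rep G "power_scale scale" V dact
    unfolding V_def dact_def by (rule linear_rep.linear_rep_power[OF V2(1)])
  note [simp] = R.act_closed
  have prime: "prime CHAR('k)"
    using prime_CHAR_semidom[where ?'a = 'k] char by simp
  then have p1: "p > 1"
    using char prime_gt_1_nat[OF prime] by simp
  have z: "X i \<in> I" "Y i \<in> I" if "i \<in> {1..n}" for i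
    using that by (auto simp: I_def coord_indices_def)
  have z_simps: "z (X i) = x i" "z (Y i) = y i" for i
    by (simp_all add: z_def)

  \<comment> \<open>The action of group elements on the coordinates of points\<close>
  define shifts where "shifts g c \<longleftrightarrow> g \<in> carrier G \<and> (\<forall>i\<in>{1..n}. \<forall>v\<in>V.
    x i (dact g v) = x i v \<and> y i (dact g v) = y i v + c * x i v)" for g c
  have shifts_one: "shifts \<one>\<^bsub>G\<^esub> 0"
    by (simp add: shifts_def R.act_one)
  have shifts_mult: "shifts (g \<otimes>\<^bsub>G\<^esub> h) (c + d)" if "shifts g c" "shifts h d" for g h c d
    using that by (auto simp: shifts_def R.act_mult algebra_simps)
  \<comment> \<open>\<open>dual_act\<close> precomposes with the inverse, so on points it is the
    inverse of \<sigma> that adds \<open>x i\<close> to \<open>y i\<close>, while \<sigma> subtracts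
    it.\<close>
  have shifts_inv: "shifts (inv\<^bsub>G\<^esub> \<sigma>) 1"
    using \<sigma>_x \<sigma>_y cyclic by (auto simp: shifts_def dual_act_def add.commute)
  have \<sigma>_inv: "dact (inv\<^bsub>G\<^esub> \<sigma>) (dact \<sigma> v) = v" if "v \<in> V" for v
    using R.act_mult[of "inv\<^bsub>G\<^esub> \<sigma>" \<sigma> v] that cyclic(2) by (simp add: R.act_one)
  have shifts_\<sigma>: "shifts \<sigma> (-1)"
    unfolding shifts_def
  proof (intro conjI ballI)
    fix i v assume iv: "i \<in> {1..n}" "v \<in> V"
    have "x i v = x i (dact \<sigma> v)" "y i v = x i (dact \<sigma> v) + y i (dact \<sigma> v)"
      using \<sigma>_x[of i "dact \<sigma> v"] \<sigma>_y[of i "dact \<sigma> v"] iv cyclic(2)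
      by (simp_all add: dual_act_def \<sigma>_inv)
    then show "x i (dact \<sigma> v) = x i v" "y i (dact \<sigma> v) = y i v + -1 * x i v"
      by simp_all
  qed fact
  \<comment> \<open>The condition \<open>c ^ p = c\<close> places the shift in the prime field; it
    is what makes \<open>u_poly p i i\<close> invariant.\<close>
  have shifts: "\<exists>c. c ^ p = c \<and> shifts g c" if "g \<in> carrier G" for g
    using that unfolding cyclic(3)[symmetric]
  proof (induction rule: generate.induct)
    case one
    show ?case
      using shifts_one p1 by (intro exI[of _ 0]) simp
  next
    case (incl h)
    \<comment> \<open>This includes \<open>p = 2\<close>, where \<open>-1 = 1\<close>.\<close>
    have "(-1 :: 'k) ^ p = -1"
      using minus_power_prime_CHAR[of p "1 :: 'k"] prime char by simp
    then show ?case
      using shifts_\<sigma> incl by auto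
  next
    case (inv h)
    then show ?case
      using shifts_inv by (intro exI[of _ 1]) simp
  next
    case (eng g h)
    then obtain c d where "c ^ p = c" "shifts g c" "d ^ p = d" "shifts h d"
      by blast
    then show ?case
      using shifts_mult freshmans_dream[OF prime] char(1) by (intro exI[of _ "c + d"]) auto
  qed
  \<comment> \<open>Conversely, powers of the inverse of \<sigma> realise every shift in the prime
    field; this later supplies the element that maps \<open>v\<close> to \<open>w\<close>.\<close>
  have shifts_of_nat: "\<exists>g. shifts g (of_nat m)" for m
  proof (induction m)
    case (Suc m)
    then show ?case
      using shifts_mult[OF shifts_inv] by auto
  qed (use shifts_one in auto)

  \<comment> \<open>Invariance of the polynomials\<close>
  interpret C: coeff_hom "Const :: 'k \<Rightarrow> (coord, 'k) mpoly"
    by (rule coeff_hom_Const)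
  have act_Var: "\<exists>c. c ^ p = c \<and> (\<forall>i\<in>{1..n}.
      form_poly V I z (dual_act G dact g (z (X i))) = Var (X i) \<and>
      form_poly V I z (dual_act G dact g (z (Y i))) = Var (Y i) + Const c * Var (X i))"
    if g: "g \<in> carrier G" for g
  proof -
    \<comment> \<open>On linear forms \<open>g\<close> acts through its inverse on points, so the
      shift of the inverse is the relevant one.\<close>
    obtain c where c: "c ^ p = c" "shifts (inv\<^bsub>G\<^esub> g) c"
      using shifts[of "inv\<^bsub>G\<^esub> g"] g by auto
    have "form_poly V I z (dual_act G dact g (z (X i))) = Var (X i) + Const 0 * Var (X i)"
      if "i \<in> {1..n}" for i
      using c(2) that by (intro form_poly_eq[OF coords] z) (auto simp: shifts_def dual_act_def z_simps)
    moreover have "form_poly V I z (dual_act G dact g (z (Y i))) = Var (Y i) + Const c * Var (X i)"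
      if "i \<in> {1..n}" for i
      using c(2) that by (intro form_poly_eq[OF coords] z) (auto simp: shifts_def dual_act_def z_simps)
    ultimately show ?thesis
      using c(1) by auto
  qed
  have frobenius: "(f + g) ^ p = f ^ p + g ^ p" for f g :: "(coord, 'k) mpoly"
    by (rule freshmans_dream) (use prime char(1) in \<open>simp_all add: CHAR_mpoly\<close>)
  have u_inv: "poly_act G V dact I z g (u_poly p i j) = u_poly p i j"
    if g: "g \<in> carrier G" and ij: "i \<in> {1..n}" "j \<in> {1..n}" for g i j
  proof -
    obtain c where c: "c ^ p = c" and act:
      "\<And>i. i \<in> {1..n} \<Longrightarrow> form_poly V I z (dual_act G dact g (z (X i))) = Var (X i)"
      "\<And>i. i \<in> {1..n} \<Longrightarrow>
         form_poly V I z (dual_act G dact g (z (Y i))) = Var (Y i) + Const c * Var (X i)"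
      using act_Var[OF g] by blast
    have "Const c ^ q = (Const (c ^ q) :: (coord, 'k) mpoly)" for q
      by (induction q) (simp_all add: C.h_mult)
    then have "(Const c :: (coord, 'k) mpoly) ^ p = Const c"
      using c by simp
    \<comment> \<open>The extra term \<open>c x^p\<close> here cancels against the one in
      \<open>x^(p-1) (y + c x)\<close>. Off the diagonal, the two extra products of \<open>c\<close>
      with both \<open>x\<close>-variables cancel each other.\<close>
    then have "(Var (Y i) + Const c * Var (X i)) ^ p =
        Var (Y i) ^ p + Const c * (Var (X i) ^ (p - 1) * Var (X i) :: (coord, 'k) mpoly)"
      using char(2) power_minus_mult[of p "Var (X i) :: (coord, 'k) mpoly"]
      by (simp add: frobenius power_mult_distrib)
    then show ?thesis
      using ij unfolding poly_act_def C.subst_poly_u_poly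
      by (auto simp: act u_poly_def algebra_simps)
  qed
  have invariant: "Var (X i) \<in> invariant_ring G V dact I z" if "i \<in> {1..n}" for i
  proof -
    have "poly_act G V dact I z g (Var (X i)) = Var (X i)" if "g \<in> carrier G" for g
      using act_Var[OF that] \<open>i \<in> {1..n}\<close> unfolding poly_act_def C.subst_poly_Var by blast
    then show ?thesis
      using z that by (simp add: invariant_ring_def coord_ring_Var)
  qed
  have invariant_S: "S_poly p n l \<in> invariant_ring G V dact I z" for l
    using u_inv S_poly_coord_ring[of p n l] unfolding invariant_ring_def S_poly_def
    by (auto simp: I_def poly_act_def C.subst_poly_sum intro!: sum.cong)

  \<comment> \<open>Separation of orbits\<close>
  interpret E: coeff_hom "\<lambda>c. c :: 'k"
    by (rule coeff_hom_id)
  have sep: "orbit G dact v = orbit G dact w"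
    if v: "v \<in> V" and w: "w \<in> V"
      and x_eq: "\<And>i. i \<in> {1..n} \<Longrightarrow> poly_value z (Var (X i)) v = poly_value z (Var (X i)) w"
      and S_eq: "\<And>l. l \<in> {2..2 * n} \<Longrightarrow>
        poly_value z (S_poly p n l) v = poly_value z (S_poly p n l) w" for v w
  proof -
    define a d where "a i = x i v" and "d i = y i w - y i v" for i
    have xw: "x i w = x i v" if "i \<in> {1..n}" for i
      using x_eq[OF that] by (simp add: poly_value_def z_simps)
    let ?P = "\<lambda>l. {(i, j). 1 \<le> i \<and> i \<le> j \<and> j \<le> n \<and> i + j = l}"
    \<comment> \<open>Frobenius applied to \<open>y i w = d i + y i v\<close> makes the nonlinear
      term of \<open>u_poly p i i\<close> additive.\<close>
    have dp: "d i ^ p = y i w ^ p - y i v ^ p" for i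
      using freshmans_dream[OF prime char(1)[symmetric], of "d i" "y i v"] by (simp add: d_def)
    define e where "e i j = (if i = j then d i ^ p - a i ^ (p - 1) * d i
      else a i * d j - a j * d i)" for i j
    have e_eq: "e i j = poly_value z (u_poly p i j) w - poly_value z (u_poly p i j) v"
      if "i \<in> {1..n}" "j \<in> {1..n}" for i j
    proof (cases "i = j")
      case True
      then have "e i j = d i ^ p - a i ^ (p - 1) * d i"
        by (simp add: e_def)
      also have "\<dots> = y i w ^ p - x i v ^ (p - 1) * y i w - (y i v ^ p - x i v ^ (p - 1) * y i v)"
        unfolding dp by (simp add: a_def d_def algebra_simps)
      finally show ?thesis
        using True that by (simp add: poly_value_def E.subst_poly_u_poly z_simps xw)
    next
      case False
      then show ?thesis
        using that by (simp add: poly_value_def E.subst_poly_u_poly z_simps xw e_def a_def d_def algebra_simps)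
    qed
    have S_value: "poly_value z (S_poly p n l) u =
        (\<Sum>q\<in>?P l. case q of (i, j) \<Rightarrow> poly_value z (u_poly p i j) u)" for l u
      unfolding S_poly_def poly_value_def E.subst_poly_sum by (rule sum.cong) (simp_all only: split_def)
    have sums: "(\<Sum>(i, j)\<in>?P l. e i j) = 0" if l: "l \<in> {2..2 * n}" for l
    proof -
      have "(\<Sum>(i, j)\<in>?P l. e i j) = poly_value z (S_poly p n l) w - poly_value z (S_poly p n l) v"
        unfolding S_value sum_subtractf[symmetric]
      proof (rule sum.cong)
        fix q assume "q \<in> ?P l"
        then obtain i j where q: "q = (i, j)" "i \<in> {1..n}" "j \<in> {1..n}"
          by auto
        show "(case q of (i, j) \<Rightarrow> e i j) =
            (case q of (i, j) \<Rightarrow> poly_value z (u_poly p i j) w) -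
            (case q of (i, j) \<Rightarrow> poly_value z (u_poly p i j) v)"
          unfolding q(1) prod.case by (rule e_eq[OF q(2,3)])
      qed simp
      then show ?thesis
        by (simp only: S_eq[OF l] diff_self)
    qed
    obtain t where t: "t ^ p = t" "\<And>i. i \<in> {1..n} \<Longrightarrow> d i = t * a i"
      using vanishing_sums_imp_multiple[of p n d a, OF p1 sums[unfolded e_def]] by blast
    obtain m where "t = of_nat m"
      using power_CHAR_fixed_imp_of_nat[OF prime t(1)[folded char(1)]] by blast
    then obtain g where g: "shifts g t"
      using shifts_of_nat by blast
    then have gG: "g \<in> carrier G"
      by (simp add: shifts_def)
    have "w = dact g v"
    proof (rule coordinates_eqI[OF coords w])
      show "dact g v \<in> V"
        using gG v by simp
      fix k assume "k \<in> I"
      then obtain i where i: "i \<in> {1..n}" "k = X i \<or> k = Y i"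
        by (auto simp: I_def coord_indices_def)
      have "y i w = y i v + t * x i v"
        using t(2)[OF i(1)] by (simp add: d_def a_def algebra_simps)
      then show "z k w = z k (dact g v)"
        using i g v xw by (auto simp: shifts_def z_simps)
    qed
    show ?thesis
    proof (intro subset_antisym subsetI)
      fix u assume "u \<in> orbit G dact v"
      then obtain h where h: "h \<in> carrier G" "u = dact h v"
        by (auto simp: orbit_def)
      \<comment> \<open>Since \<open>w = g v\<close>, the point \<open>h v\<close> equals
        \<open>(h g^-1) w\<close>.\<close>
      have "dact (h \<otimes>\<^bsub>G\<^esub> inv\<^bsub>G\<^esub> g) w = dact (h \<otimes>\<^bsub>G\<^esub> inv\<^bsub>G\<^esub> g \<otimes>\<^bsub>G\<^esub> g) v"
        unfolding \<open>w = dact g v\<close> using gG h v by (subst R.act_mult[symmetric]) auto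
      also have "\<dots> = u"
        using gG h by (simp add: R.m_assoc)
      finally show "u \<in> orbit G dact w"
        using gG h(1) unfolding orbit_def by (intro image_eqI[where x = "h \<otimes>\<^bsub>G\<^esub> inv\<^bsub>G\<^esub> g"]) auto
    next
      fix u assume "u \<in> orbit G dact w"
      then obtain h where "h \<in> carrier G" "u = dact (h \<otimes>\<^bsub>G\<^esub> g) v"
        using \<open>w = dact g v\<close> gG v by (auto simp: orbit_def R.act_mult)
      then show "u \<in> orbit G dact v"
        using gG by (auto simp: orbit_def)
    qed
  qed
  show ?thesis
    unfolding separating_set_def
  proof (intro conjI ballI impI)
    fix v w assume vw: "v \<in> V" "w \<in> V" "orbit G dact v \<noteq> orbit G dact w"
    show "\<exists>h\<in>{Var (X i) | i. i \<in> {1..n}} \<union> {S_poly p n l | l. l \<in> {2..2 * n}}.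
        poly_value z h v \<noteq> poly_value z h w"
    proof (rule ccontr)
      assume "\<not> ?thesis"
      then have "orbit G dact v = orbit G dact w"
        by (intro sep[OF vw(1,2)]) blast+
      then show False
        using vw(3) by contradiction
    qed
  qed (use invariant invariant_S in blast)
qed

end
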